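(* We have $$\sum_{k=1}^\infty \frac{(-1)^k}{k^2 \binom{2k}{k} \binom{3k}{k}} \left( \frac{7k-2}{2k-1} (2 H_{2k-1} - H_{k-1}) + \frac{1}{k} \right) = - \frac{3}{2} \zeta(3)$$ and $$\sum_{k=1}^{\infty} \frac{(-1)^k}{k^2\binom{2k}{k}\binom{3k}{k}}\left(\frac{7 k-2}{2 k-1} H_{k-1}^{(2)}-\frac{3}{4 k^2}\right)=\frac{\pi^4}{720}.$$
   Context: For integers $m\ge1$ and $n\ge0$, $H_n^{(m)}=\sum_{0<j\le n}\frac1{j^m}$ denotes the harmonic number of order $m$, and $H_n=H_n^{(1)}$ (so $H_0=H_0^{(m)}=0$). $\zeta$ is the Riemann zeta function. *)

theory Defs
  imports "HOL-Analysis.Analysis"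
begin

definition harm_order :: "nat \<Rightarrow> nat \<Rightarrow> real" where
  "harm_order m n = (\<Sum>j\<in>{0<..n}. 1 / real j ^ m)"

lemma harm_order_1: "harm_order 1 n = harm n"
  by (simp add: harm_order_def harm_def inverse_eq_divide atLeastSucAtMost_greaterThanAtMost [symmetric])

text \<open>The Riemann zeta function on real arguments \<open>s > 1\<close>, where it is given by its Dirichlet
  series. For \<open>s \<le> 1\<close> the series diverges and the value below is meaningless; the analytic
  continuation is not covered.\<close>

definition zeta :: "real \<Rightarrow> real" where
  "zeta s = (\<Sum>n. 1 / real (Suc n) powr s)"

end

theory Submission
  imports Defs "HOL-Real_Asymp.Real_Asymp"
begin

text \<open>
  Both series come from Dougall's bilateral \<open>\<^sub>2H\<^sub>2\<close> summation theorem by the Wilf--Zeilberger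
  method. That theorem says that a suitable multiple of
  \<open>\<Gamma>(a+k) \<Gamma>(b+k) \<Gamma>(c-a) \<Gamma>(c-b) \<Gamma>(d-a) \<Gamma>(d-b) / (\<Gamma>(c+k) \<Gamma>(d+k) \<Gamma>(c+d-a-b-1))\<close>
  has a sum over all integers \<open>k\<close> which is unaffected by integer shifts of \<open>a, b, c, d\<close>. Moving
  along \<open>(a, b, c, d) + n (1, 0, 2, 2)\<close> therefore makes it a term \<open>F(n,k)\<close> that has a WZ mate:
  \<open>F(n+1,k) - F(n,k) = G(n,k+1) - G(n,k)\<close>. Summation over the quadrant \<open>n, k \<ge> 0\<close> gives
  \<open>\<Sum>\<^sub>n G(n,0) = \<Sum>\<^sub>k F(0,k)\<close>. At \<open>(a, b, c, d) = (1, 1, 2, 2)\<close> the right side is \<open>\<Sum> 1/k\<^sup>2\<close>, and the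
  left side is, up to a constant factor, the series with terms
  \<open>(-1)\<^sup>k (7k-2) / ((2k-1) k\<^sup>2 (2k choose k) (3k choose k))\<close>.

  The harmonic numbers appear when the parameters are perturbed by a small \<open>s\<close> and the
  coefficients of \<open>s\<close> and \<open>s\<^sup>2\<close> are compared (after division by a factor that is independent of
  \<open>n\<close> and \<open>k\<close>). The factor \<open>(3n)!\<close> must not contribute, so
  \<open>c + d - a - b\<close> is kept fixed.

  \<^item> Along \<open>(4s, 2s, 3s, 3s)\<close> the first-order coefficient of \<open>F(0,k)\<close> is
    \<open>-6/(k+1)\<^sup>3\<close>, and that of \<open>G(n,0)\<close> is four times the first series.
  \<^item> Along \<open>(s, 0, \<gamma>, \<delta>)\<close> with \<open>\<gamma> + \<delta> = s\<close> and \<open>\<gamma>\<^sup>2 + \<delta>\<^sup>2 = 0\<close> (so \<open>\<gamma>\<close> and \<open>\<delta>\<close> are complex, but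
    only \<open>\<gamma> + \<delta> = s\<close> and \<open>\<gamma>\<delta> = s\<^sup>2/2\<close> matter) every pair of factors \<open>(x + \<gamma>)(x + \<delta>)\<close> equals
    \<open>x\<^sup>2 exp(s/x)\<close> up to \<open>O(s\<^sup>3)\<close>. So second-order harmonic numbers come only from \<open>\<Gamma>(a+n+k)\<close>.
    The coefficient of \<open>s\<^sup>2\<close> in \<open>G(n,0)\<close> is the second series, and the one of \<open>F(0,k)\<close> is
    \<open>(1/(k+1)\<^sup>4 - H\<^sub>k\<^sup>(\<^sup>2\<^sup>) / (k+1)\<^sup>2) / 2\<close>.

  The perturbation only serves to find these coefficients. They again satisfy the WZ equation,
  which after division by a common hypergeometric factor amounts to one polynomial identity for
  each power of \<open>s\<close>, namely \<open>cert_step_0\<close>, \<open>cert_step_1\<close>, \<open>cert_step_2\<close> and \<open>cert_step_zeta3\<close>. The value of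
  the last sum follows from \<open>\<Sum> H\<^sub>k\<^sup>(\<^sup>2\<^sup>) / (k+1)\<^sup>2 = \<pi>\<^sup>4/120\<close>, the coefficient of \<open>x\<^sup>4\<close> in
  Euler's product for \<open>sin (\<pi> x) / (\<pi> x)\<close>.
\<close>

section \<open>Harmonic numbers\<close>

lemma harm_order_0 [simp]: "harm_order m 0 = 0"
  by (simp add: harm_order_def)

lemma harm_order_Suc: "harm_order m (Suc n) = harm_order m n + 1 / (real n + 1) ^ m"
proof -
  have "{0<..Suc n} = insert (Suc n) {0<..n}"
    by auto
  thus ?thesis
    by (simp add: harm_order_def add.commute)
qed

lemma harm_order_eq_sum: "harm_order m n = (\<Sum>j<n. 1 / (real j + 1) ^ m)"
  by (induction n) (simp_all add: harm_order_Suc)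

lemma harm_order_nonneg: "harm_order m n \<ge> 0"
  by (simp add: harm_order_eq_sum sum_nonneg)

lemma inverse_squares_sums': "(\<lambda>n. 1 / (real n + 1) ^ 2) sums (pi ^ 2 / 6)"
  using inverse_squares_sums by (simp add: add.commute)

lemma harm_order_2_le: "harm_order 2 n \<le> pi ^ 2 / 6"
  unfolding harm_order_eq_sum sums_unique[OF inverse_squares_sums']
  by (rule sum_le_suminf[OF sums_summable[OF inverse_squares_sums']]) auto

lemma harm_order_2_tendsto: "harm_order 2 \<longlonglongrightarrow> pi ^ 2 / 6"
  using inverse_squares_sums' by (simp add: sums_def harm_order_eq_sum[abs_def])

lemma harm_Suc': "(harm (Suc n) :: real) = harm n + 1 / (real n + 1)"
  by (simp add: harm_Suc inverse_eq_divide add.commute)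

lemma harm_diff_le:
  assumes "m \<le> n"
  shows "(harm m :: real) \<le> harm n" "(harm n :: real) \<le> harm m + (real n - real m)"
proof -
  have "(harm m :: real) \<le> harm n \<and> harm n \<le> harm m + (real n - real m)"
    using assms
  proof (induction n rule: dec_induct)
    case (step n)
    have "0 \<le> 1 / (real n + 1)" "1 / (real n + 1) \<le> 1"
      by auto
    with step.IH show ?case
      unfolding harm_Suc' of_nat_Suc by linarith
  qed auto
  thus "(harm m :: real) \<le> harm n" "(harm n :: real) \<le> harm m + (real n - real m)"
    by auto
qed


section \<open>Summation of a WZ pair over a quadrant\<close>

text \<open>
  Summing the WZ equation over \<open>k\<close> leaves only the boundary term \<open>- G n 0\<close> on the right. Hence the row
  sums of \<open>F\<close> change by \<open>- G n 0\<close> from row to row, and they tend to zero.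
\<close>
lemma WZ_sums:
  fixes F G :: "nat \<Rightarrow> nat \<Rightarrow> real"
  assumes WZ: "\<And>n k. F (Suc n) k - F n k = G n (Suc k) - G n k"
    and F_le: "\<And>n k. \<bar>F n k\<bar> \<le> c n / (real k + 1) ^ 2"
    and c: "c \<longlonglongrightarrow> 0"
    and G: "\<And>n. G n \<longlonglongrightarrow> 0"
  shows "(\<lambda>n. G n 0) sums (\<Sum>k. F 0 k)"
proof -
  define S where "S n = (\<Sum>k. F n k)" for n
  have major: "(\<lambda>k. c n / (real k + 1) ^ 2) sums (c n * (pi ^ 2 / 6))" for n
    using sums_mult[OF inverse_squares_sums', of "c n"] by simp
  have summable: "summable (F n)" for n
    by (rule summable_comparison_test'[OF sums_summable[OF major[of n]], of 0])
       (simp add: F_le)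
  have S_bound: "norm (S n) \<le> c n * (pi ^ 2 / 6)" for n
    unfolding S_def sums_unique[OF major[of n]]
    by (rule norm_suminf_le[OF _ sums_summable[OF major[of n]]]) (simp add: F_le)
  have "S \<longlonglongrightarrow> 0"
  proof (rule Lim_null_comparison)
    show "\<forall>\<^sub>F n in sequentially. norm (S n) \<le> c n * (pi ^ 2 / 6)"
      by (simp only: S_bound eventually_True)
    show "(\<lambda>n. c n * (pi ^ 2 / 6)) \<longlonglongrightarrow> 0"
      using tendsto_mult_left_zero[OF c] by simp
  qed
  hence "(\<lambda>n. S n - S (Suc n)) sums (S 0 - 0)"
    by (rule telescope_sums')
  moreover have "S n - S (Suc n) = G n 0" for n
  proof -
    have "(\<lambda>k. F (Suc n) k - F n k) sums (0 - G n 0)"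
      unfolding WZ by (rule telescope_sums[OF G])
    moreover have "(\<lambda>k. F (Suc n) k - F n k) sums (S (Suc n) - S n)"
      unfolding S_def by (intro sums_diff summable_sums summable)
    ultimately show ?thesis
      using sums_unique2 by fastforce
  qed
  ultimately show ?thesis
    by (simp add: S_def)
qed


section \<open>The kernel\<close>

text \<open>
  The term \<open>F(n,k)\<close> at \<open>(a, b, c, d) = (1, 1, 2, 2)\<close>. The sign \<open>(-1)\<^sup>n\<close> stems from the reflection
  factor \<open>\<pi>\<^sup>2 / (sin (\<pi> a) sin (\<pi> b))\<close> in Dougall's theorem.
\<close>
definition kernel :: "nat \<Rightarrow> nat \<Rightarrow> real" where
  "kernel n k = (-1) ^ n * fact (n + k) * fact k * fact (2 * n) ^ 2 * fact n ^ 2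
                  / (fact (2 * n + k + 1) ^ 2 * fact (3 * n))"

text \<open>
  The mate of the kernel is this term times a polynomial. The squared factor is \<open>(c+k)(d+k)\<close>, and
  there are three linear factors because \<open>c+d-a-b-1\<close> grows by three when \<open>n\<close> grows by one.
\<close>
definition mate_kernel :: "nat \<Rightarrow> nat \<Rightarrow> real" where
  "mate_kernel n k = kernel n k /
     ((2*real n + real k + 2)^2 * ((3*real n + 1) * (3*real n + 2) * (3*real n + 3)))"

text \<open>All four terms of the WZ equation are polynomial multiples of this term.\<close>
definition common_factor :: "nat \<Rightarrow> nat \<Rightarrow> real" where
  "common_factor n k = mate_kernel n k / (2*real n + real k + 3)^2"

lemma kernel_Suc_left:
  "kernel (Suc n) k = kernel n k *
     (- ((real n + real k + 1) * (real n + 1)^2 * (2*real n + 1)^2 * (2*real n + 2)^2)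
      / ((2*real n + real k + 2)^2 * (2*real n + real k + 3)^2
         * ((3*real n + 1) * (3*real n + 2) * (3*real n + 3))))"
proof -
  have "fact (Suc n + k) = (real n + real k + 1) * fact (n + k)"
    by (simp add: algebra_simps)
  moreover have "fact (2 * Suc n) = (2*real n + 2) * (2*real n + 1) * (fact (2 * n) :: real)"
    by (simp add: algebra_simps)
  moreover have "fact (Suc n) = (real n + 1) * (fact n :: real)"
    by (simp add: algebra_simps)
  moreover have "2 * Suc n + k + 1 = Suc (Suc (2 * n + k + 1))"
    by simp
  hence "fact (2 * Suc n + k + 1)
           = (2*real n + real k + 3) * (2*real n + real k + 2) * (fact (2 * n + k + 1) :: real)"
    by (simp only: fact_Suc of_nat_Suc of_nat_add of_nat_mult) (simp add: algebra_simps)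
  moreover have "3 * Suc n = Suc (Suc (Suc (3 * n)))"
    by simp
  hence "fact (3 * Suc n)
           = (3*real n + 3) * (3*real n + 2) * (3*real n + 1) * (fact (3 * n) :: real)"
    by (simp only: fact_Suc of_nat_Suc of_nat_mult) (simp add: algebra_simps)
  ultimately show ?thesis
    unfolding kernel_def by (simp only:) (simp add: power_mult_distrib mult_ac)
qed

lemma kernel_Suc_right:
  "kernel n (Suc k) = kernel n k *
     ((real k + 1) * (real n + real k + 1) / (2*real n + real k + 2)^2)"
proof -
  have "fact (n + Suc k) = (real n + real k + 1) * fact (n + k)"
    by (simp add: algebra_simps)
  moreover have "fact (Suc k) = (real k + 1) * (fact k :: real)"
    by (simp add: algebra_simps)
  moreover have "fact (2 * n + Suc k + 1) = (2*real n + real k + 2) * (fact (2 * n + k + 1) :: real)"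
    by (simp add: algebra_simps)
  ultimately show ?thesis
    unfolding kernel_def by (simp only:) (simp add: power_mult_distrib mult_ac)
qed

lemma kernel_eq_common_factor:
  "kernel n k = common_factor n k *
     ((3*real n + 1) * (3*real n + 2) * (3*real n + 3)
      * (2*real n + real k + 2)^2 * (2*real n + real k + 3)^2)"
  "kernel (Suc n) k = common_factor n k *
     - ((real n + real k + 1) * (real n + 1)^2 * (2*real n + 1)^2 * (2*real n + 2)^2)"
  "mate_kernel n k = common_factor n k * (2*real n + real k + 3)^2"
  "mate_kernel n (Suc k) = common_factor n k * ((real k + 1) * (real n + real k + 1))"
proof -
  have nz: "2*real n + real k + 2 \<noteq> 0" "2*real n + real k + 3 \<noteq> 0"
    "3*real n + 1 \<noteq> 0" "3*real n + 2 \<noteq> 0" "3*real n + 3 \<noteq> 0"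
    by linarith+
  show mate: "mate_kernel n k = common_factor n k * (2*real n + real k + 3)^2"
    using nz by (simp add: common_factor_def)
  show kern: "kernel n k = common_factor n k *
     ((3*real n + 1) * (3*real n + 2) * (3*real n + 3)
      * (2*real n + real k + 2)^2 * (2*real n + real k + 3)^2)"
    using nz by (simp add: common_factor_def mate_kernel_def)
  show "kernel (Suc n) k = common_factor n k *
     - ((real n + real k + 1) * (real n + 1)^2 * (2*real n + 1)^2 * (2*real n + 2)^2)"
    unfolding kernel_Suc_left common_factor_def mate_kernel_def by (simp add: mult_ac)
  show "mate_kernel n (Suc k) = common_factor n k * ((real k + 1) * (real n + real k + 1))"
    unfolding common_factor_def mate_kernel_def kernel_Suc_right by (simp add: mult_ac add_ac)
qed

lemma kernel_0: "kernel 0 k = 1 / (real k + 1) ^ 2"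
  by (simp add: kernel_def power2_eq_square add.commute)

lemma abs_kernel_le: "\<bar>kernel n k\<bar> \<le> (1/3) ^ n / (real k + 1) ^ 2"
proof (induction n)
  case 0
  show ?case by (simp add: kernel_0)
next
  case (Suc n)
  define p where "p = (real n + real k + 1) * (real n + 1)^2 * (2*real n + 1)^2 * (2*real n + 2)^2"
  define q where "q = (2*real n + real k + 2)^2 * (2*real n + real k + 3)^2
                        * ((3*real n + 1) * (3*real n + 2) * (3*real n + 3))"
  have "p \<ge> 0" "q > 0"
    unfolding p_def q_def by auto
  have "3 * p \<le> q"
  proof -
    have "p = (real n + real k + 1) * (2*real n + 2) * (2*real n + 1)^2 * (2 * (real n + 1)^3)"
      unfolding p_def by algebra
    also have "\<dots> \<le> (2*real n + real k + 2) * (2*real n + real k + 2) * (2*real n + real k + 3)^2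
                      * (2 * (real n + 1)^3)"
      by (intro mult_mono power_mono) auto
    finally have "3 * p \<le> (2*real n + real k + 2)^2 * (2*real n + real k + 3)^2
                            * (6 * (real n + 1)^3)"
      by (simp add: power2_eq_square mult_ac)
    also have "\<dots> \<le> q"
    proof -
      have "6 * (real n + 1)^3 = (real n + 1) * (2*real n + 2) * (3*real n + 3)"
        by algebra
      also have "\<dots> \<le> (3*real n + 1) * (3*real n + 2) * (3*real n + 3)"
        by (intro mult_mono) auto
      finally show ?thesis
        unfolding q_def by (intro mult_left_mono) auto
    qed
    finally show ?thesis .
  qed
  have "\<bar>kernel (Suc n) k\<bar> = \<bar>kernel n k\<bar> * (p / q)"
    using \<open>p \<ge> 0\<close> \<open>q > 0\<close> unfolding kernel_Suc_left p_def[symmetric] q_def[symmetric]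
    by (simp add: abs_mult)
  also have "\<dots> \<le> (1/3) ^ n / (real k + 1) ^ 2 * (1/3)"
    using Suc \<open>3 * p \<le> q\<close> \<open>p \<ge> 0\<close> \<open>q > 0\<close>
    by (intro mult_mono) (auto simp: field_simps)
  finally show ?case by simp
qed

lemma abs_mate_kernel_le: "\<bar>mate_kernel n k\<bar> \<le> 1 / (real k + 1) ^ 4"
proof -
  define q where
    "q = (2*real n + real k + 2)^2 * ((3*real n + 1) * (3*real n + 2) * (3*real n + 3))"
  have "(real k + 1) ^ 2 * (1 * 1 * 1) \<le> q"
    unfolding q_def by (intro mult_mono power_mono) auto
  moreover have "\<bar>kernel n k\<bar> \<le> 1 / (real k + 1) ^ 2"
  proof -
    have "(1/3) ^ n / (real k + 1) ^ 2 \<le> 1 / (real k + 1) ^ 2"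
      by (intro divide_right_mono power_le_one) auto
    with abs_kernel_le[of n k] show ?thesis
      by linarith
  qed
  ultimately have "\<bar>kernel n k\<bar> / q \<le> 1 / (real k + 1) ^ 2 / (real k + 1) ^ 2"
    by (intro frac_le) auto
  moreover have "q > 0"
    unfolding q_def by auto
  ultimately show ?thesis
    by (simp add: mate_kernel_def q_def[symmetric] abs_mult flip: power_add)
qed

text \<open>
  The certificates below are cubic in \<open>k\<close>, hence of smaller order than \<open>(k+1)\<^sup>4\<close>.
\<close>
lemma mate_kernel_mult_tendsto_0:
  assumes q: "(\<lambda>k. q k / (real k + 1) ^ 4) \<longlonglongrightarrow> 0" and h: "\<And>k. \<bar>h k\<bar> \<le> B"
  shows "(\<lambda>k. mate_kernel n k * (q k * h k)) \<longlonglongrightarrow> 0"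
proof (rule Lim_null_comparison)
  show "\<forall>\<^sub>F k in sequentially. norm (mate_kernel n k * (q k * h k)) \<le> \<bar>q k / (real k + 1) ^ 4\<bar> * B"
  proof (intro always_eventually allI)
    fix k
    have "\<bar>mate_kernel n k\<bar> * (\<bar>q k\<bar> * \<bar>h k\<bar>) \<le> 1 / (real k + 1) ^ 4 * (\<bar>q k\<bar> * B)"
      using abs_mate_kernel_le[of n k] h[of k] by (intro mult_mono) auto
    thus "norm (mate_kernel n k * (q k * h k)) \<le> \<bar>q k / (real k + 1) ^ 4\<bar> * B"
      by (simp add: abs_mult)
  qed
  show "(\<lambda>k. \<bar>q k / (real k + 1) ^ 4\<bar> * B) \<longlonglongrightarrow> 0"
    using tendsto_mult_left_zero[OF tendsto_rabs_zero[OF q]] .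
qed


section \<open>The certificates\<close>

text \<open>
  For general parameters write \<open>e = c+d-a-b-1\<close>, \<open>X = (c-a)(d-a)\<close>, \<open>Y = (c-b)(d-b)\<close>,
  \<open>Z = (c+k)(d+k)\<close>. Then the mate of \<open>F\<close> is \<open>F q / (e (e+1) (e+2) Z)\<close>, where
  \<open>q = (e+2) ((e+1) (e+k+a) - Y) Z + X Y (k+c+d+1-b)\<close>.
  The following polynomials are coefficients of \<open>q\<close> at
  \<open>(a, b, c, d) = (n+1, 1, 2n+2, 2n+2)\<close> plus a perturbation: \<open>cert_0\<close>, \<open>cert_1\<close>, \<open>cert_2\<close> are those of
  \<open>1, s, s\<^sup>2\<close> for \<open>(s, 0, \<gamma>, \<delta>)\<close>, \<open>\<gamma> + \<delta> = s\<close>, \<open>\<gamma>\<delta> = s\<^sup>2/2\<close>, and \<open>cert_zeta3\<close> is that of \<open>s\<close> for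
  \<open>(4s, 2s, 3s, 3s)\<close>.
\<close>
definition cert_0 :: "real \<Rightarrow> real \<Rightarrow> real" where
  "cert_0 n k = (3*n+3) * ((3*n+2) * (4*n+k+2) - (2*n+1)^2) * (2*n+k+2)^2
                + (n+1)^2 * (2*n+1)^2 * (k+4*n+4)"

definition cert_1 :: "real \<Rightarrow> real \<Rightarrow> real" where
  "cert_1 n k = (3*n+3) * (((3*n+2) - (2*n+1)) * (2*n+k+2)^2
                           + ((3*n+2) * (4*n+k+2) - (2*n+1)^2) * (2*n+k+2))
                + ((n+1)^2*(2*n+1) - (n+1)*(2*n+1)^2) * (k+4*n+4) + (n+1)^2*(2*n+1)^2"

definition cert_2 :: "real \<Rightarrow> real \<Rightarrow> real" where
  "cert_2 n k = (3*n+3) * (((3*n+2) - (2*n+1)) * (2*n+k+2) - (2*n+k+2)^2 / 2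
                           + ((3*n+2) * (4*n+k+2) - (2*n+1)^2) / 2)
                + ((2*n+1)^2/2 - (n+1)*(2*n+1) + (n+1)^2/2) * (k+4*n+4)
                + ((n+1)^2*(2*n+1) - (n+1)*(2*n+1)^2)"

definition cert_zeta3 :: "real \<Rightarrow> real \<Rightarrow> real" where
  "cert_zeta3 n k = (3*n+3) * ((4 * (3*n+2) - 2*(2*n+1)) * (2*n+k+2)^2
                               + 6 * ((3*n+2) * (4*n+k+2) - (2*n+1)^2) * (2*n+k+2))
                + (2*(n+1)^2*(2*n+1) - 2*(n+1)*(2*n+1)^2) * (k+4*n+4) + 4*(n+1)^2*(2*n+1)^2"

text \<open>
  With \<open>Y', Z'\<close> denoting \<open>(c-b+1)(d-b+1)\<close> and \<open>Z\<close> at \<open>k+1\<close>, the WZ equation for general parameters is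
  \<open>- (a+k) X Y Y' - e (e+1) (e+2) Z Z' = (a+k) (b+k) q(k+1) - Z' q(k)\<close>.
  The next four identities are its coefficients of \<open>1, s, s\<^sup>2\<close>, and of \<open>s\<close> in the other direction.
\<close>
lemma cert_step_0:
  "- ((n+k+1) * (n+1)^2 * (2*n+1)^2 * (2*n+2)^2)
   - (3*n+1)*(3*n+2)*(3*n+3) * ((2*n+k+2)^2 * (2*n+k+3)^2)
   = (k+1) * (n+k+1) * cert_0 n (k+1) - (2*n+k+3)^2 * cert_0 n k"
  unfolding cert_0_def by algebra

lemma cert_step_1:
  "- ((n+1)^2 * (2*n+1)^2 * (2*n+2)^2
      + (n+k+1) * ((n+1)^2*(2*n+1)*(2*n+2)^2 + (n+1)^2*(2*n+1)^2*(2*n+2)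
                   - (n+1)*(2*n+1)^2*(2*n+2)^2))
   - (3*n+1)*(3*n+2)*(3*n+3) * ((2*n+k+2) * (2*n+k+3)^2 + (2*n+k+2)^2 * (2*n+k+3))
   = ((k+1) * (n+k+1) * cert_1 n (k+1) + (k+1) * cert_0 n (k+1))
     - ((2*n+k+3)^2 * cert_1 n k + (2*n+k+3) * cert_0 n k)"
  unfolding cert_0_def cert_1_def by algebra

lemma cert_step_2:
  "- (((n+1)^2*(2*n+1)*(2*n+2)^2 + (n+1)^2*(2*n+1)^2*(2*n+2) - (n+1)*(2*n+1)^2*(2*n+2)^2)
      + (n+k+1) * (2*(n+1)^4 - 2*(n+1)^3*(2*n+1) + (n+1)^2*(2*n+1)^2 / 2))
   - (3*n+1)*(3*n+2)*(3*n+3) * ((4*n+2*k+5)^2 / 2)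
   = ((k+1) * (n+k+1) * cert_2 n (k+1) + (k+1) * cert_1 n (k+1))
     - ((2*n+k+3)^2 * cert_2 n k + (2*n+k+3) * cert_1 n k + cert_0 n k / 2)"
proof -
  obtain h :: real where h: "2 * h = 1" and half: "\<And>z. z / 2 = z * h"
    by (rule that[of "1/2"]) auto
  show ?thesis
    unfolding cert_0_def cert_1_def cert_2_def half using h by algebra
qed

lemma cert_step_zeta3:
  "- (4 * (n+1)^2 * (2*n+1)^2 * (2*n+2)^2
      + (n+k+1) * (2*(n+1)^2*(2*n+1)*(2*n+2)^2 + 2*(n+1)^2*(2*n+1)^2*(2*n+2)
                   - 2*(n+1)*(2*n+1)^2*(2*n+2)^2))
   - (3*n+1)*(3*n+2)*(3*n+3) * (6*(2*n+k+2) * (2*n+k+3)^2 + 6*(2*n+k+2)^2 * (2*n+k+3))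
   = ((k+1) * (n+k+1) * cert_zeta3 n (k+1) + (4*(k+1) + 2*(n+k+1)) * cert_0 n (k+1))
     - ((2*n+k+3)^2 * cert_zeta3 n k + 6*(2*n+k+3) * cert_0 n k)"
  unfolding cert_0_def cert_zeta3_def by algebra

lemma cert_growth:
  assumes "n \<ge> 0"
  shows "(\<lambda>k::nat. cert_0 n (real k) / (real k + 1) ^ 4) \<longlonglongrightarrow> 0"
    and "(\<lambda>k::nat. cert_1 n (real k) / (real k + 1) ^ 4) \<longlonglongrightarrow> 0"
    and "(\<lambda>k::nat. cert_2 n (real k) / (real k + 1) ^ 4) \<longlonglongrightarrow> 0"
    and "(\<lambda>k::nat. cert_zeta3 n (real k) / (real k + 1) ^ 4) \<longlonglongrightarrow> 0"
  unfolding cert_0_def cert_1_def cert_2_def cert_zeta3_def by real_asymp+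


text \<open>
  How such identities imply a WZ equation: \<open>w\<close> is the common factor, and \<open>1, l, u\<close> are the harmonic
  expressions by which the coefficients of the various orders get multiplied.
\<close>
lemma WZ_equation_from_coefficients:
  fixes w :: real
  assumes "F' = w * (u * a0 + l * a1 + a2)" "F = w * (u * b0 + l * b1 + b2)"
    and "G' = w * (u * c0 + l * c1 + c2)" "G = w * (u * d0 + l * d1 + d2)"
    and "a0 - b0 = c0 - d0" "a1 - b1 = c1 - d1" "a2 - b2 = c2 - d2"
  shows "F' - F = G' - G"
  using assms by algebra


section \<open>The first-order pair\<close>

text \<open>
  The logarithmic derivative of \<open>F\<close> along \<open>(4s, 2s, 3s, 3s)\<close> is \<open>log_deriv_zeta3 n k (2n+k+1)\<close>; dividing
  by \<open>Z\<close> or by \<open>Z Z'\<close> moves the last argument to \<open>2n+k+2\<close> or \<open>2n+k+3\<close>.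
\<close>
definition log_deriv_zeta3 :: "nat \<Rightarrow> nat \<Rightarrow> nat \<Rightarrow> real" where
  "log_deriv_zeta3 n k m =
     4 * harm (n + k) + 2 * harm k - 2 * harm n + 2 * harm (2 * n) - 6 * harm m"

definition F_zeta3 :: "nat \<Rightarrow> nat \<Rightarrow> real" where
  "F_zeta3 n k = kernel n k * log_deriv_zeta3 n k (2*n+k+1)"

definition G_zeta3 :: "nat \<Rightarrow> nat \<Rightarrow> real" where
  "G_zeta3 n k = mate_kernel n k * (cert_0 n k * log_deriv_zeta3 n k (2*n+k+2) + cert_zeta3 n k)"

lemma WZ_zeta3: "F_zeta3 (Suc n) k - F_zeta3 n k = G_zeta3 n (Suc k) - G_zeta3 n k"
proof -
  define x y where "x = real n" and "y = real k"
  define w where "w = common_factor n k"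
  define l where "l = log_deriv_zeta3 n k (2*n+k+3)"
  have nz: "x+1 \<noteq> 0" "2*x+1 \<noteq> 0" "2*x+2 \<noteq> 0" "y+1 \<noteq> 0" "x+y+1 \<noteq> 0" "2*x+y+2 \<noteq> 0" "2*x+y+3 \<noteq> 0"
    unfolding x_def y_def by linarith+
  have idx: "Suc n + k = Suc (n + k)" "2 * Suc n = Suc (Suc (2 * n))"
    "2 * n + k + 2 = Suc (2 * n + k + 1)" "2 * n + k + 3 = Suc (Suc (2 * n + k + 1))"
    "Suc (Suc (2 * n)) + k + 1 = Suc (Suc (2 * n + k + 1))" "n + Suc k = Suc (n + k)"
    "2 * n + Suc k + 2 = Suc (Suc (2 * n + k + 1))" by simp_all
  have l1: "log_deriv_zeta3 n k (2*n+k+1) = l + 6 * (1/(2*x+y+2)) + 6 * (1/(2*x+y+3))"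
    and l2: "log_deriv_zeta3 (Suc n) k (2 * Suc n+k+1)
               = l + 4 * (1/(x+y+1)) - 2 * (1/(x+1)) + 2 * (1/(2*x+1)) + 2 * (1/(2*x+2))"
    and l3: "log_deriv_zeta3 n k (2*n+k+2) = l + 6 * (1/(2*x+y+3))"
    and l4: "log_deriv_zeta3 n (Suc k) (2*n+Suc k+2) = l + 4 * (1/(x+y+1)) + 2 * (1/(y+1))"
    unfolding log_deriv_zeta3_def l_def idx harm_Suc' x_def y_def
    by (simp_all add: algebra_simps)
  have r: "1/(x+1) * (x+1) = 1" "1/(2*x+1) * (2*x+1) = 1" "1/(2*x+2) * (2*x+2) = 1"
    "1/(y+1) * (y+1) = 1" "1/(x+y+1) * (x+y+1) = 1"
    "1/(2*x+y+2) * (2*x+y+2) = 1" "1/(2*x+y+3) * (2*x+y+3) = 1"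
    using nz by simp_all
  have Suc: "real (Suc k) = y + 1"
    by (simp add: y_def)
  (* Only the orders 1 and l occur here, so the component u is set to zero. *)
  show ?thesis
  proof (rule WZ_equation_from_coefficients[where u = 0, OF _ _ _ _ refl cert_step_0 cert_step_zeta3])
    show "F_zeta3 (Suc n) k = w * (0 * 0 + l * - ((x+y+1) * (x+1)^2 * (2*x+1)^2 * (2*x+2)^2)
          + - (4 * (x+1)^2 * (2*x+1)^2 * (2*x+2)^2
               + (x+y+1) * (2*(x+1)^2*(2*x+1)*(2*x+2)^2 + 2*(x+1)^2*(2*x+1)^2*(2*x+2)
                            - 2*(x+1)*(2*x+1)^2*(2*x+2)^2)))"
      unfolding F_zeta3_def kernel_eq_common_factor(2)[of n k] l2
        w_def[symmetric] x_def[symmetric] y_def[symmetric]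
      using r(1,2,3,5) by algebra
    show "F_zeta3 n k = w * (0 * 0 + l * ((3*x+1)*(3*x+2)*(3*x+3) * ((2*x+y+2)^2 * (2*x+y+3)^2))
          + (3*x+1)*(3*x+2)*(3*x+3)
            * (6*(2*x+y+2) * (2*x+y+3)^2 + 6*(2*x+y+2)^2 * (2*x+y+3)))"
      unfolding F_zeta3_def kernel_eq_common_factor(1)[of n k] l1
        w_def[symmetric] x_def[symmetric] y_def[symmetric]
      using r(6,7) by algebra
    show "G_zeta3 n (Suc k) = w * (0 * 0 + l * ((y+1) * (x+y+1) * cert_0 x (y+1))
          + ((y+1) * (x+y+1) * cert_zeta3 x (y+1) + (4*(y+1) + 2*(x+y+1)) * cert_0 x (y+1)))"
      unfolding G_zeta3_def kernel_eq_common_factor(4)[of n k] l4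
        w_def[symmetric] x_def[symmetric] y_def[symmetric] Suc
      using r(4,5) by algebra
    show "G_zeta3 n k = w * (0 * 0 + l * ((2*x+y+3)^2 * cert_0 x y)
          + ((2*x+y+3)^2 * cert_zeta3 x y + 6*(2*x+y+3) * cert_0 x y))"
      unfolding G_zeta3_def kernel_eq_common_factor(3)[of n k] l3
        w_def[symmetric] x_def[symmetric] y_def[symmetric]
      using r(7) by algebra
  qed
qed

lemma abs_log_deriv_zeta3_le:
  assumes "2*n+k+1 \<le> m" "m \<le> 2*n+k+2"
  shows "\<bar>log_deriv_zeta3 n k m\<bar> \<le> 10 * real n + 12"
proof -
  have "m \<le> n + k + (n + 2)" "m \<le> k + (2*n + 2)"
    using assms by auto
  hence m: "real m \<le> real (n + k) + real n + 2" "real m \<le> real k + 2 * real n + 2"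
    by (simp_all flip: of_nat_add of_nat_mult)
  show ?thesis
    using harm_diff_le[of "n + k" m] harm_diff_le[of k m] harm_diff_le[of n "2 * n"] assms m
    unfolding log_deriv_zeta3_def by (simp; linarith)
qed

lemma G_zeta3_sums: "(\<lambda>n. G_zeta3 n 0) sums (\<Sum>k. F_zeta3 0 k)"
proof (rule WZ_sums[where F = F_zeta3 and G = G_zeta3, OF WZ_zeta3])
  fix n k
  have "\<bar>kernel n k\<bar> * \<bar>log_deriv_zeta3 n k (2*n+k+1)\<bar>
          \<le> (1/3) ^ n / (real k + 1) ^ 2 * (10 * real n + 12)"
    by (intro mult_mono abs_kernel_le abs_log_deriv_zeta3_le) auto
  thus "\<bar>F_zeta3 n k\<bar> \<le> ((1/3) ^ n * (10 * real n + 12)) / (real k + 1) ^ 2"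
    by (simp add: F_zeta3_def abs_mult)
next
  show "(\<lambda>n. (1/3) ^ n * (10 * real n + 12)) \<longlonglongrightarrow> 0"
    by real_asymp
next
  fix n
  have "(\<lambda>k. mate_kernel n k * (cert_0 n k * log_deriv_zeta3 n k (2*n+k+2))
             + mate_kernel n k * (cert_zeta3 n k * 1)) \<longlonglongrightarrow> 0 + 0"
    by (intro tendsto_add mate_kernel_mult_tendsto_0[OF _ abs_log_deriv_zeta3_le]
          mate_kernel_mult_tendsto_0[where B = 1] cert_growth) auto
  thus "G_zeta3 n \<longlonglongrightarrow> 0"
    by (simp add: G_zeta3_def[abs_def] algebra_simps)
qed

lemma zeta_3_sums: "(\<lambda>n. 1 / (real n + 1) ^ 3) sums zeta 3"
proof -
  have "summable (\<lambda>n. 1 / real (Suc n) ^ 3)"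
    using inverse_power_summable[of 3, where 'a = real]
    by (subst summable_Suc_iff[where f = "\<lambda>n. 1 / real n ^ 3"]) (simp add: inverse_eq_divide)
  hence "(\<lambda>n. 1 / real (Suc n) ^ 3) sums (\<Sum>n. 1 / real (Suc n) ^ 3)"
    by (rule summable_sums)
  thus ?thesis
    by (simp add: zeta_def add.commute)
qed

lemma F_zeta3_0: "F_zeta3 0 k = -6 * (1 / (real k + 1) ^ 3)"
proof -
  have "log_deriv_zeta3 0 k (2*0+k+1) = -6 / (real k + 1)"
    by (simp add: log_deriv_zeta3_def harm_Suc' harm_expand)
  thus ?thesis
    by (simp add: F_zeta3_def kernel_0 power2_eq_square power3_eq_cube)
qed

lemma F_zeta3_suminf: "(\<Sum>k. F_zeta3 0 k) = -6 * zeta 3"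
  unfolding F_zeta3_0 using sums_mult[OF zeta_3_sums, of "-6"] by (rule sums_unique[symmetric])


section \<open>The second-order pair\<close>

text \<open>
  Along the direction \<open>(s, 0, \<gamma>, \<delta>)\<close>, \<open>F\<close> gets multiplied by \<open>1 + s h + s\<^sup>2 (h\<^sup>2 - H\<^sup>(\<^sup>2\<^sup>)) / 2 + O(s\<^sup>3)\<close>,
  where \<open>h\<close> is \<open>log_deriv_zeta4 n k (2n+k+1)\<close> and \<open>H\<^sup>(\<^sup>2\<^sup>)\<close> is taken at \<open>n + k\<close>; the last argument of \<open>h\<close>
  again accounts for division by \<open>Z\<close> and \<open>Z'\<close>. (A factor \<open>1 + s\<^sup>2 \<zeta>(2) / 2\<close>, independent of \<open>n\<close> and
  \<open>k\<close>, is left out.)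
\<close>
definition log_deriv_zeta4 :: "nat \<Rightarrow> nat \<Rightarrow> nat \<Rightarrow> real" where
  "log_deriv_zeta4 n k m = harm (n + k) - harm n + harm (2 * n) - harm m"

definition quad_coeff :: "nat \<Rightarrow> nat \<Rightarrow> nat \<Rightarrow> real" where
  "quad_coeff n k m = (log_deriv_zeta4 n k m ^ 2 - harm_order 2 (n + k)) / 2"

definition F_zeta4 :: "nat \<Rightarrow> nat \<Rightarrow> real" where
  "F_zeta4 n k = kernel n k * quad_coeff n k (2*n+k+1)"

definition G_zeta4 :: "nat \<Rightarrow> nat \<Rightarrow> real" where
  "G_zeta4 n k = mate_kernel n k * (cert_0 n k * quad_coeff n k (2*n+k+2)
                   + cert_1 n k * log_deriv_zeta4 n k (2*n+k+2) + cert_2 n k)"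

lemma WZ_zeta4: "F_zeta4 (Suc n) k - F_zeta4 n k = G_zeta4 n (Suc k) - G_zeta4 n k"
proof -
  define x y where "x = real n" and "y = real k"
  define w where "w = common_factor n k"
  define l where "l = log_deriv_zeta4 n k (2*n+k+3)"
  define u where "u = quad_coeff n k (2*n+k+3)"
  have nz: "x+1 \<noteq> 0" "2*x+1 \<noteq> 0" "2*x+2 \<noteq> 0" "y+1 \<noteq> 0" "x+y+1 \<noteq> 0" "2*x+y+2 \<noteq> 0" "2*x+y+3 \<noteq> 0"
    unfolding x_def y_def by linarith+
  have idx: "Suc n + k = Suc (n + k)" "2 * Suc n = Suc (Suc (2 * n))"
    "2 * n + k + 2 = Suc (2 * n + k + 1)" "2 * n + k + 3 = Suc (Suc (2 * n + k + 1))"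
    "Suc (Suc (2 * n)) + k + 1 = Suc (Suc (2 * n + k + 1))" "n + Suc k = Suc (n + k)"
    "2 * n + Suc k + 2 = Suc (Suc (2 * n + k + 1))" by simp_all
  have l1: "log_deriv_zeta4 n k (2*n+k+1) = l + (1/(2*x+y+2) + 1/(2*x+y+3))"
    and l2': "log_deriv_zeta4 (Suc n) k (2 * Suc n+k+1)
                = l + (1/(x+y+1) + (1/(2*x+1) + 1/(2*x+2) - 1/(x+1)))"
    and l3: "log_deriv_zeta4 n k (2*n+k+2) = l + 1/(2*x+y+3)"
    and l4: "log_deriv_zeta4 n (Suc k) (2*n+Suc k+2) = l + 1/(x+y+1)"
    unfolding log_deriv_zeta4_def l_def idx harm_Suc' x_def y_def
    by (simp_all add: algebra_simps)
  have "1/(2*x+2) - 1/(x+1) = - (1/(2*x+2))"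
  proof -
    have eq: "2*x+2 = 2*(x+1)" by simp
    have "1/(2*a) - 1/a = - (1/(2*a))" if "a \<noteq> 0" for a :: real
      using that by (simp add: field_simps)
    from this[OF nz(1)] show ?thesis
      unfolding eq .
  qed
  hence l2: "log_deriv_zeta4 (Suc n) k (2 * Suc n+k+1) = l + (1/(x+y+1) + (1/(2*x+1) - 1/(2*x+2)))"
    unfolding l2' by linarith
  have H: "harm_order 2 (Suc (n + k)) = harm_order 2 (n + k) + (1/(x+y+1))^2"
    by (simp add: harm_order_Suc x_def y_def power_divide)
  have expand: "((l + a)^2 - h) / 2 = (l^2 - h) / 2 + l * a + a^2 / 2"
    and expand_Suc: "((l + (a + b))^2 - (h + a^2)) / 2 = (l^2 - h) / 2 + l * (a + b) + (a * b + b^2 / 2)"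
    for a b h :: real
    by (simp_all add: power2_eq_square field_simps)
  have u1: "quad_coeff n k (2*n+k+1)
              = u + l * (1/(2*x+y+2) + 1/(2*x+y+3)) + (1/(2*x+y+2) + 1/(2*x+y+3))^2 / 2"
    and u3: "quad_coeff n k (2*n+k+2) = u + l * (1/(2*x+y+3)) + (1/(2*x+y+3))^2 / 2"
    unfolding quad_coeff_def u_def l1 l3 l_def[symmetric] by (rule expand)+
  have u2: "quad_coeff (Suc n) k (2 * Suc n+k+1)
              = u + l * (1/(x+y+1) + (1/(2*x+1) - 1/(2*x+2)))
                + (1/(x+y+1) * (1/(2*x+1) - 1/(2*x+2)) + (1/(2*x+1) - 1/(2*x+2))^2 / 2)"
    unfolding quad_coeff_def u_def l2 l_def[symmetric] unfolding idx(1) H by (rule expand_Suc)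
  have u4: "quad_coeff n (Suc k) (2*n+Suc k+2) = u + l * (1/(x+y+1))"
    unfolding quad_coeff_def u_def l4 l_def[symmetric] unfolding idx(6) H
    using expand_Suc[of "1/(x+y+1)" 0] by simp
  show ?thesis
  proof (rule WZ_equation_from_coefficients[OF _ _ _ _ cert_step_0 cert_step_1 cert_step_2])
    show "F_zeta4 (Suc n) k = w * (u * - ((x+y+1) * (x+1)^2 * (2*x+1)^2 * (2*x+2)^2)
          + l * - ((x+1)^2 * (2*x+1)^2 * (2*x+2)^2
                   + (x+y+1) * ((x+1)^2*(2*x+1)*(2*x+2)^2 + (x+1)^2*(2*x+1)^2*(2*x+2)
                                - (x+1)*(2*x+1)^2*(2*x+2)^2))
          + - (((x+1)^2*(2*x+1)*(2*x+2)^2 + (x+1)^2*(2*x+1)^2*(2*x+2) - (x+1)*(2*x+1)^2*(2*x+2)^2)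
               + (x+y+1) * (2*(x+1)^4 - 2*(x+1)^3*(2*x+1) + (x+1)^2*(2*x+1)^2 / 2)))"
    proof -
      define v s where "v = 1/(2*x+1) - 1/(2*x+2)" and "s = 1/(x+y+1)"
      define p where "p = (x+1)^2 * (2*x+1)^2 * (2*x+2)^2"
      have s: "s * (x+y+1) = 1"
        unfolding s_def using nz by simp
      have v: "v * ((2*x+1) * (2*x+2)) = 1"
      proof -
        have "(1/b - 1/c) * (b * c) = c - b" if "b \<noteq> 0" "c \<noteq> 0" for b c :: real
          using that by (simp add: field_simps)
        from this[OF nz(2,3)] show ?thesis
          unfolding v_def by simp
      qed
      have "p * v = (x+1)^2 * (2*x+1) * (2*x+2) * (v * ((2*x+1) * (2*x+2)))"
        unfolding p_def by algebra
      also have "\<dots> = (x+1)^2*(2*x+1)*(2*x+2)^2 + (x+1)^2*(2*x+1)^2*(2*x+2) - (x+1)*(2*x+1)^2*(2*x+2)^2"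
        unfolding v by algebra
      finally have pv: "p * v = \<dots>" .
      have "p * v^2 = (x+1)^2 * (v * ((2*x+1) * (2*x+2)))^2"
        unfolding p_def by algebra
      also have "\<dots> = 4*(x+1)^4 - 4*(x+1)^3*(2*x+1) + (x+1)^2*(2*x+1)^2"
        unfolding v power_one mult_1_right by algebra
      finally have pv2: "p * (v^2 / 2) = 2*(x+1)^4 - 2*(x+1)^3*(2*x+1) + (x+1)^2*(2*x+1)^2 / 2"
        by (simp add: field_simps)
      have "- (t * p) * (u + l * (s + v) + (s * v + c))
              = u * - (t * p) + l * - (p + t * (p * v)) + - (p * v + t * (p * c))"
        if "s * t = 1" for t c
        using that by algebra
      from arg_cong[OF this[OF s, of "v^2 / 2"], of "\<lambda>z. w * z"] show ?thesis
        unfolding F_zeta4_def kernel_eq_common_factor(2)[of n k] u2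
          w_def[symmetric] x_def[symmetric] y_def[symmetric] v_def[symmetric] s_def[symmetric]
          pv pv2 by (simp only: p_def mult.assoc)
    qed
    show "F_zeta4 n k = w * (u * ((3*x+1)*(3*x+2)*(3*x+3) * ((2*x+y+2)^2 * (2*x+y+3)^2))
          + l * ((3*x+1)*(3*x+2)*(3*x+3) * ((2*x+y+2) * (2*x+y+3)^2 + (2*x+y+2)^2 * (2*x+y+3)))
          + (3*x+1)*(3*x+2)*(3*x+3) * ((4*x+2*y+5)^2 / 2))"
    proof -
      define v where "v = 1/(2*x+y+2) + 1/(2*x+y+3)"
      define e where "e = (3*x+1)*(3*x+2)*(3*x+3)"
      define p where "p = (2*x+y+2)^2 * (2*x+y+3)^2"
      have v: "(2*x+y+2) * (2*x+y+3) * v = 4*x+2*y+5"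
      proof -
        have "b * c * (1/b + 1/c) = b + c" if "b \<noteq> 0" "c \<noteq> 0" for b c :: real
          using that by (simp add: field_simps)
        from this[OF nz(6,7)] show ?thesis
          unfolding v_def by simp
      qed
      have "p * v = (2*x+y+2) * (2*x+y+3) * ((2*x+y+2) * (2*x+y+3) * v)"
        unfolding p_def by algebra
      also have "\<dots> = (2*x+y+2) * (2*x+y+3)^2 + (2*x+y+2)^2 * (2*x+y+3)"
        unfolding v by algebra
      finally have pv: "p * v = \<dots>" .
      have "p * v^2 = ((2*x+y+2) * (2*x+y+3) * v)^2"
        unfolding p_def by algebra
      hence pv2: "p * (v^2 / 2) = (4*x+2*y+5)^2 / 2"
        unfolding v by simp
      have "e * p * (u + l * v + v^2 / 2) = u * (e * p) + l * (e * (p * v)) + e * (p * (v^2 / 2))"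
        by (simp add: algebra_simps)
      from arg_cong[OF this, of "\<lambda>z. w * z"] show ?thesis
        unfolding F_zeta4_def kernel_eq_common_factor(1)[of n k] u1
          w_def[symmetric] x_def[symmetric] y_def[symmetric] v_def[symmetric] e_def[symmetric]
          pv pv2 by (simp only: p_def mult.assoc)
    qed
    show "G_zeta4 n (Suc k) = w * (u * ((y+1) * (x+y+1) * cert_0 x (y+1))
          + l * ((y+1) * (x+y+1) * cert_1 x (y+1) + (y+1) * cert_0 x (y+1))
          + ((y+1) * (x+y+1) * cert_2 x (y+1) + (y+1) * cert_1 x (y+1)))"
    proof -
      have Suc: "real (Suc k) = y + 1"
        by (simp add: y_def)
      have "v * t * (q0 * (u + l * (1 / t)) + q1 * (l + 1 / t) + q2)
              = u * (v * t * q0) + l * (v * t * q1 + v * q0) + (v * t * q2 + v * q1)"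
        if "t \<noteq> 0" for v t q0 q1 q2 :: real
        using that by (simp add: field_simps)
      from this[OF nz(5), of "y+1"] show ?thesis
        unfolding G_zeta4_def kernel_eq_common_factor(4)[of n k] u4 l4
          w_def[symmetric] x_def[symmetric] y_def[symmetric] Suc
        by (simp only: mult.assoc)
    qed
    show "G_zeta4 n k = w * (u * ((2*x+y+3)^2 * cert_0 x y)
          + l * ((2*x+y+3)^2 * cert_1 x y + (2*x+y+3) * cert_0 x y)
          + ((2*x+y+3)^2 * cert_2 x y + (2*x+y+3) * cert_1 x y + cert_0 x y / 2))"
    proof -
      define z q0 q1 q2 where "z = 2*x+y+3"
        and "q0 = cert_0 x y" and "q1 = cert_1 x y" and "q2 = cert_2 x y"
      have "z \<noteq> 0"
        using nz by (simp add: z_def)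
      thus ?thesis
        unfolding G_zeta4_def kernel_eq_common_factor(3)[of n k] u3 l3
          w_def[symmetric] x_def[symmetric] y_def[symmetric] z_def[symmetric]
          q0_def[symmetric] q1_def[symmetric] q2_def[symmetric]
        by (simp add: field_simps power2_eq_square)
    qed
  qed
qed

lemma abs_log_deriv_zeta4_le:
  assumes "2*n+k+1 \<le> m" "m \<le> 2*n+k+2"
  shows "\<bar>log_deriv_zeta4 n k m\<bar> \<le> 2 * real n + 2"
proof -
  have "m \<le> n + k + (n + 2)"
    using assms by auto
  hence m: "real m \<le> real (n + k) + real n + 2"
    by (simp flip: of_nat_add of_nat_mult)
  show ?thesis
    using harm_diff_le[of "n + k" m] harm_diff_le[of n "2 * n"] assms m
    unfolding log_deriv_zeta4_def by (simp; linarith)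
qed

lemma abs_quad_coeff_le:
  assumes "2*n+k+1 \<le> m" "m \<le> 2*n+k+2"
  shows "\<bar>quad_coeff n k m\<bar> \<le> (2 * real n + 2) ^ 2 + pi ^ 2"
proof -
  have "log_deriv_zeta4 n k m ^ 2 \<le> (2 * real n + 2) ^ 2"
    using abs_log_deriv_zeta4_le[OF assms] by (simp add: abs_le_square_iff[symmetric])
  moreover have "\<bar>(a - h) / 2\<bar> \<le> q + p" if "0 \<le> a" "a \<le> q" "0 \<le> h" "h \<le> p / 6" for a h p q :: real
    using that by (auto simp: abs_le_iff divide_simps)
  ultimately show ?thesis
    unfolding quad_coeff_def using harm_order_nonneg harm_order_2_le by simp
qed

lemma G_zeta4_sums: "(\<lambda>n. G_zeta4 n 0) sums (\<Sum>k. F_zeta4 0 k)"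
proof (rule WZ_sums[where F = F_zeta4 and G = G_zeta4, OF WZ_zeta4])
  fix n k
  have "\<bar>kernel n k\<bar> * \<bar>quad_coeff n k (2*n+k+1)\<bar>
          \<le> (1/3) ^ n / (real k + 1) ^ 2 * ((2 * real n + 2) ^ 2 + pi ^ 2)"
    by (intro mult_mono abs_kernel_le abs_quad_coeff_le) auto
  thus "\<bar>F_zeta4 n k\<bar> \<le> ((1/3) ^ n * ((2 * real n + 2) ^ 2 + pi ^ 2)) / (real k + 1) ^ 2"
    by (simp add: F_zeta4_def abs_mult)
next
  show "(\<lambda>n. (1/3) ^ n * ((2 * real n + 2) ^ 2 + pi ^ 2)) \<longlonglongrightarrow> 0"
    by real_asymp
next
  fix n
  have "(\<lambda>k. mate_kernel n k * (cert_0 n k * quad_coeff n k (2*n+k+2))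
             + mate_kernel n k * (cert_1 n k * log_deriv_zeta4 n k (2*n+k+2))
             + mate_kernel n k * (cert_2 n k * 1)) \<longlonglongrightarrow> 0 + 0 + 0"
    by (intro tendsto_add mate_kernel_mult_tendsto_0[OF _ abs_quad_coeff_le]
          mate_kernel_mult_tendsto_0[OF _ abs_log_deriv_zeta4_le]
          mate_kernel_mult_tendsto_0[where B = 1] cert_growth) auto
  thus "G_zeta4 n \<longlonglongrightarrow> 0"
    by (simp add: G_zeta4_def[abs_def] algebra_simps)
qed

lemma F_zeta4_0:
  "F_zeta4 0 k = 1/2 * (1 / (real k + 1) ^ 4 - harm_order 2 k / (real k + 1) ^ 2)"
proof -
  have "log_deriv_zeta4 0 k (2*0+k+1) = -1 / (real k + 1)"
    by (simp add: log_deriv_zeta4_def harm_Suc' harm_expand)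
  thus ?thesis
    by (simp add: F_zeta4_def quad_coeff_def kernel_0 power_divide diff_divide_distrib
          right_diff_distrib flip: power_add)
qed


section \<open>Two double series of weight four\<close>

text \<open>
  Truncating the expanded product after the term linear in \<open>x\<^sup>2\<close> makes an error of at most the square
  of that term.
\<close>
lemma sine_partial_product_bounds:
  fixes x :: real
  assumes "0 < x" "x \<le> 1"
  defines "P \<equiv> \<lambda>n. \<Prod>k=1..n. 1 - x^2 / real k ^ 2"
  shows "1 - x^2 * harm_order 2 n \<le> P n"
    and "P n \<le> 1 - x^2 * harm_order 2 n + (x^2 * harm_order 2 n)^2"
proof -
  have "1 - x^2 * harm_order 2 n \<le> P n \<and> P n \<le> 1 - x^2 * harm_order 2 n + (x^2 * harm_order 2 n)^2"
  proof (induction n)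
    case (Suc n)
    define t u where "t = x^2 * harm_order 2 n" and "u = x^2 / (real n + 1)^2"
    have u: "0 \<le> u" "u \<le> 1"
    proof -
      show "0 \<le> u" by (simp add: u_def)
      have "x^2 \<le> 1" "1 \<le> (real n + 1)^2"
        using assms by (auto simp: power_le_one one_le_power)
      hence "x^2 \<le> (real n + 1)^2"
        by linarith
      thus "u \<le> 1"
        unfolding u_def by (simp add: divide_simps)
    qed
    have t: "0 \<le> t"
      by (simp add: t_def harm_order_nonneg)
    have PS: "P (Suc n) = P n * (1 - u)"
      by (simp add: P_def u_def add.commute)
    have HS: "x^2 * harm_order 2 (Suc n) = t + u"
      by (simp add: harm_order_Suc t_def u_def distrib_left)
    have IH: "1 - t \<le> P n" "P n \<le> 1 - t + t^2"
      using Suc by (simp_all add: t_def)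
    have "1 - (t + u) \<le> (1 - t) * (1 - u)"
      using t u by (simp add: algebra_simps)
    also have "\<dots> \<le> P (Suc n)"
      unfolding PS using IH u by (intro mult_right_mono) auto
    finally have "1 - (t + u) \<le> P (Suc n)" .
    moreover have "P (Suc n) \<le> (1 - t + t^2) * (1 - u)"
      unfolding PS using IH u by (intro mult_right_mono) auto
    moreover have "(1 - t + t^2) * (1 - u) = 1 - (t + u) + (t + u)^2 - (t * u + u^2 + t^2 * u)"
      by algebra
    moreover have "0 \<le> t * u + u^2 + t^2 * u"
      using t u by simp
    ultimately show ?case
      unfolding HS by linarith
  qed (simp_all add: P_def)
  thus "1 - x^2 * harm_order 2 n \<le> P n"
    and "P n \<le> 1 - x^2 * harm_order 2 n + (x^2 * harm_order 2 n)^2"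
    by auto
qed

text \<open>
  Let \<open>P n\<close> be the partial products of \<open>sin (\<pi> x) / (\<pi> x)\<close>. Telescoping \<open>P n - P (n+1)\<close> and
  subtracting the result from \<open>\<Sum> 1/(n+1)\<^sup>2 = \<pi>\<^sup>2/6\<close> expresses the Taylor remainder of the sine
  quotient after two terms, divided by \<open>x\<^sup>4\<close>, as \<open>\<Sum> (1 - P n) / x\<^sup>2 / (n+1)\<^sup>2\<close>, and \<open>(1 - P n) / x\<^sup>2\<close> differs from the harmonic number by \<open>O(x\<^sup>2)\<close>
  uniformly in \<open>n\<close>.
\<close>
lemma zeta_2_2_sums: "(\<lambda>n. harm_order 2 n / (real n + 1) ^ 2) sums (pi ^ 4 / 120)"
proof -
  define T where "T = (\<Sum>n. harm_order 2 n / (real n + 1) ^ 2)"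
  define g where "g x = (pi^2/6 - (1 - sin (pi * x) / (pi * x)) / x^2) / x^2" for x :: real
  have summable: "summable (\<lambda>n. harm_order 2 n / (real n + 1) ^ 2)"
  proof (rule summable_comparison_test'[of "\<lambda>n. pi^2/6 * (1 / (real n + 1) ^ 2)" 0])
    show "summable (\<lambda>n. pi^2/6 * (1 / (real n + 1) ^ 2))"
      using sums_mult[OF inverse_squares_sums'] by (rule sums_summable)
    show "norm (harm_order 2 n / (real n + 1) ^ 2) \<le> pi^2/6 * (1 / (real n + 1) ^ 2)" for n
      using harm_order_nonneg[of 2 n] harm_order_2_le[of n]
      by (simp add: abs_of_nonneg divide_right_mono del: divide_divide_eq_left)
  qed
  have approx: "norm (T - g x) \<le> x^2 * ((pi^2/6)^2 * (pi^2/6))" if x: "0 < x" "x \<le> 1" for x :: real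
  proof -
    define P where "P n = (\<Prod>k=1..n. 1 - x^2 / real k ^ 2)" for n
    have "(\<lambda>n. P n - P (Suc n)) sums (P 0 - sin (pi * x) / (pi * x))"
      unfolding P_def using x by (intro telescope_sums' sin_product_formula_real') auto
    moreover have "P n - P (Suc n) = P n / (real n + 1) ^ 2 * x^2" for n
      by (simp add: P_def algebra_simps)
    ultimately have "(\<lambda>n. P n / (real n + 1) ^ 2 * x^2) sums (1 - sin (pi * x) / (pi * x))"
      by (simp add: P_def)
    from sums_divide[OF this, of "x^2"]
    have "(\<lambda>n. P n / (real n + 1) ^ 2) sums ((1 - sin (pi * x) / (pi * x)) / x^2)"
      using x by simp
    from sums_divide[OF sums_diff[OF inverse_squares_sums' this], of "x^2"]
    have g: "(\<lambda>n. (1 / (real n + 1) ^ 2 - P n / (real n + 1) ^ 2) / x^2) sums g x"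
      by (simp add: g_def)
    have diff: "(\<lambda>n. harm_order 2 n / (real n + 1) ^ 2
                  - (1 / (real n + 1) ^ 2 - P n / (real n + 1) ^ 2) / x^2) sums (T - g x)"
      unfolding T_def by (intro sums_diff g summable_sums summable)
    have major: "(\<lambda>n. x^2 * (pi^2/6)^2 * (1 / (real n + 1) ^ 2)) sums (x^2 * (pi^2/6)^2 * (pi^2/6))"
      by (intro sums_mult inverse_squares_sums')
    have "norm (T - g x) \<le> x^2 * (pi^2/6)^2 * (pi^2/6)"
      unfolding sums_unique[OF diff] sums_unique[OF major]
    proof (rule norm_suminf_le[OF _ sums_summable[OF major]])
      fix n
      define h where "h = harm_order 2 n"
      have h: "0 \<le> h" "h \<le> pi^2/6"
        using harm_order_nonneg harm_order_2_le by (auto simp: h_def)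
      have "1 - x^2 * h \<le> P n" "P n \<le> 1 - x^2 * h + (x^2 * h)^2"
        using sine_partial_product_bounds[OF x, of n] by (simp_all add: P_def h_def)
      hence "\<bar>x^2 * h - (1 - P n)\<bar> \<le> (x^2 * h)^2"
        by (intro abs_leI) auto
      hence "\<bar>x^2 * h - (1 - P n)\<bar> / x^2 \<le> (x^2 * h)^2 / x^2"
        by (intro divide_right_mono) auto
      hence "\<bar>(x^2 * h - (1 - P n)) / x^2\<bar> \<le> x^2 * h^2"
        using x by (simp add: abs_divide power2_eq_square mult_ac)
      also have "\<dots> \<le> x^2 * (pi^2/6)^2"
        using h by (intro mult_left_mono power_mono) auto
      finally have "\<bar>(x^2 * h - (1 - P n)) / x^2\<bar> * (1 / (real n + 1) ^ 2)
                      \<le> x^2 * (pi^2/6)^2 * (1 / (real n + 1) ^ 2)"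
        by (intro mult_right_mono) auto
      moreover have "h / (real n + 1) ^ 2 - (1 / (real n + 1) ^ 2 - P n / (real n + 1) ^ 2) / x^2
               = (x^2 * h - (1 - P n)) / x^2 * (1 / (real n + 1) ^ 2)"
        using x by (simp add: field_simps)
      ultimately show "norm (harm_order 2 n / (real n + 1) ^ 2
               - (1 / (real n + 1) ^ 2 - P n / (real n + 1) ^ 2) / x^2)
               \<le> x^2 * (pi^2/6)^2 * (1 / (real n + 1) ^ 2)"
        unfolding h_def[symmetric] by (simp add: abs_mult)
    qed
    thus ?thesis by simp
  qed
  have "((\<lambda>x. T - g x) \<longlongrightarrow> 0) (at_right 0)"
  proof (rule Lim_null_comparison)
    show "\<forall>\<^sub>F x in at_right 0. norm (T - g x) \<le> x^2 * ((pi^2/6)^2 * (pi^2/6))"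
      by (rule eventually_mono[OF eventually_at_right_real[of 0 1]]) (simp, rule approx, auto)
    show "((\<lambda>x. x^2 * ((pi^2/6)^2 * (pi^2/6))) \<longlongrightarrow> 0) (at_right 0)"
      by (auto intro!: tendsto_eq_intros)
  qed
  hence "(g \<longlongrightarrow> T) (at_right 0)"
    using tendsto_diff[OF tendsto_const[of T]] by fastforce
  moreover have "(g \<longlongrightarrow> pi ^ 4 / 120) (at_right 0)"
  proof -
    have "((\<lambda>y::real. (1/6 - (1 - sin y / y) / y^2) / y^2) \<longlongrightarrow> 1/120) (at_right 0)"
      by real_asymp
    moreover have "filterlim (\<lambda>x. pi * x) (at_right 0) (at_right 0)"
      by real_asymp
    ultimately have "((\<lambda>x. (1/6 - (1 - sin (pi * x) / (pi * x)) / (pi * x)^2) / (pi * x)^2)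
                        \<longlongrightarrow> 1/120) (at_right 0)"
      by (rule filterlim_compose)
    from tendsto_mult_left[OF this, of "pi ^ 4"]
    have lim: "((\<lambda>x. pi ^ 4 * ((1/6 - (1 - sin (pi * x) / (pi * x)) / (pi * x)^2) / (pi * x)^2))
                 \<longlongrightarrow> pi ^ 4 / 120) (at_right 0)"
      by simp
    have "pi ^ 4 * ((1/6 - (1 - sin (pi * x) / (pi * x)) / (pi * x)^2) / (pi * x)^2) = g x"
      if "0 < x" for x
    proof -
      have "pi ^ 4 * ((1/6 - s / (pi * x)^2) / (pi * x)^2) = (pi^2/6 - s / x^2) / x^2" for s :: real
        using that by (simp add: field_simps power2_eq_square power4_eq_xxxx)
      thus ?thesis by (simp only: g_def)
    qed
    hence "\<forall>\<^sub>F x in at_right 0.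
             pi ^ 4 * ((1/6 - (1 - sin (pi * x) / (pi * x)) / (pi * x)^2) / (pi * x)^2) = g x"
      using eventually_at_right_less[of "0::real"] by (auto elim: eventually_mono)
    with lim show ?thesis
      by (rule Lim_transform_eventually)
  qed
  ultimately have "T = pi ^ 4 / 120"
    by (intro tendsto_unique[of "at_right (0::real)" g]) auto
  with summable_sums[OF summable] show ?thesis
    by (simp only: T_def)
qed

text \<open>
  Squaring \<open>\<Sum> 1/k\<^sup>2\<close> term by term gives \<open>\<zeta>(2)\<^sup>2 = 2 \<zeta>(2,2) + \<zeta>(4)\<close>, so the required difference
  \<open>\<zeta>(4) - \<zeta>(2,2)\<close> is \<open>\<zeta>(2)\<^sup>2 - 3 \<zeta>(2,2)\<close>.
\<close>
lemma F_zeta4_suminf: "(\<Sum>k. F_zeta4 0 k) = pi ^ 4 / 720"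
proof -
  have "(\<lambda>n. harm_order 2 (Suc n) ^ 2 - harm_order 2 n ^ 2) sums ((pi ^ 2 / 6) ^ 2 - harm_order 2 0 ^ 2)"
    by (intro telescope_sums tendsto_power harm_order_2_tendsto)
  from sums_diff[OF this sums_mult[OF zeta_2_2_sums, of 3]]
  have "(\<lambda>n. harm_order 2 (Suc n) ^ 2 - harm_order 2 n ^ 2 - 3 * (harm_order 2 n / (real n + 1) ^ 2))
          sums (pi ^ 4 / 360)"
    by (simp add: power_divide flip: power_mult)
  moreover have "harm_order 2 (Suc n) ^ 2 - harm_order 2 n ^ 2 - 3 * (harm_order 2 n / (real n + 1) ^ 2)
                   = 1 / (real n + 1) ^ 4 - harm_order 2 n / (real n + 1) ^ 2" for n
  proof -
    have "(a + b)^2 - a^2 - 3 * (a * b) = b^2 - a * b" for a b :: real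
      by algebra
    from this[of "harm_order 2 n" "1 / (real n + 1)^2"] show ?thesis
      by (simp add: harm_order_Suc power_divide flip: power_mult)
  qed
  ultimately have "(\<lambda>n. 1 / (real n + 1) ^ 4 - harm_order 2 n / (real n + 1) ^ 2) sums (pi ^ 4 / 360)"
    by simp
  from sums_mult[OF this, of "1/2"] show ?thesis
    unfolding F_zeta4_0 by (simp add: sums_iff)
qed


section \<open>The two series\<close>

lemma binomial_product: "real (2 * k choose k) * real (3 * k choose k) = fact (3 * k) / fact k ^ 3"
proof -
  have "real (2 * k choose k) = fact (2 * k) / (fact k * fact k)"
    by (subst binomial_fact) (auto simp: mult_2)
  moreover have "real (3 * k choose k) = fact (3 * k) / (fact k * fact (2 * k))"
    by (subst binomial_fact) auto
  ultimately show ?thesis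
    by (simp add: power3_eq_cube)
qed

lemma mate_kernel_0:
  defines "b \<equiv> \<lambda>k. real k ^ 2 * real (2 * k choose k) * real (3 * k choose k)"
  shows "mate_kernel n 0 =
           - ((-1) ^ Suc n / b (Suc n)) / ((real n + 1) * (2*real n + 1)^2 * (2*real n + 2)^2)"
proof -
  define x where "x = real n"
  define f g h :: real where "f = fact n" and "g = fact (3 * n)" and "h = fact (2 * n)"
  define e where "e = (3*x+1) * (3*x+2) * (3*x+3)"
  have "x \<ge> 0"
    by (simp add: x_def)
  hence nz: "x+1 \<noteq> 0" "2*x+1 \<noteq> 0" "2*x+2 \<noteq> 0" "e \<noteq> 0" "f \<noteq> 0" "g \<noteq> 0" "h \<noteq> 0"
    by (auto simp: e_def f_def g_def h_def)
  have "3 * Suc n = Suc (Suc (Suc (3 * n)))"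
    by simp
  hence "fact (3 * Suc n) = (3*x+3) * (3*x+2) * (3*x+1) * g"
    unfolding x_def g_def by (simp only: fact_Suc of_nat_Suc of_nat_mult) (simp add: algebra_simps)
  moreover have "fact (Suc n) = (x+1) * f"
    by (simp add: x_def f_def algebra_simps)
  ultimately have "b (Suc n) = (x+1)^2 * ((3*x+3) * (3*x+2) * (3*x+1) * g) / ((x+1) * f)^3"
    unfolding b_def mult.assoc binomial_product by (simp add: x_def add.commute)
  also have "\<dots> = (x+1)^2 * (e * g) / ((x+1) * f)^3"
    by (simp add: e_def mult_ac)
  also have "\<dots> = e * (g / f^3) / (x+1)"
    using nz(1) by (simp add: power_mult_distrib power2_eq_square power3_eq_cube)
  finally have b: "b (Suc n) = e * (g / f^3) / (x+1)" .
  have "fact (2 * n + 1) = (2*x+1) * h"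
    by (simp add: x_def h_def algebra_simps)
  hence "mate_kernel n 0 = (-1)^n * (f^3 * h^2 / (((2*x+1) * h)^2 * g)) / ((2*x+2)^2 * e)"
    by (simp add: mate_kernel_def kernel_def f_def g_def h_def x_def e_def
          power2_eq_square power3_eq_cube mult_ac add_ac)
  also have "f^3 * h^2 / (((2*x+1) * h)^2 * g) = 1 / ((g / f^3) * (2*x+1)^2)"
    using nz by (simp add: power_mult_distrib)
  also have "(-1)^n * \<dots> / ((2*x+2)^2 * e)
               = - ((-1) ^ Suc n / (e * (g / f^3) / (x+1))) / ((x+1) * (2*x+1)^2 * (2*x+2)^2)"
    using nz by simp
  finally show ?thesis
    by (simp only: x_def b)
qed

text \<open>
  In terms of \<open>a = n + 1\<close> and \<open>b = 2n + 1\<close> the certificates factor on the boundary \<open>k = 0\<close>; the factor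
  \<open>3a + 2b = 7n + 5\<close> becomes \<open>7k - 2\<close> for \<open>k = n + 1\<close>.
\<close>
lemma cert_boundary:
  fixes n :: real
  defines "a \<equiv> n + 1" and "b \<equiv> 2*n + 1"
  shows "cert_0 n 0 = 8 * a^3 * b * (3*a + 2*b)"
    and "cert_1 n 0 = a^2 * (12*a^2 + 16*a*b + 3*b^2)"
    and "cert_2 n 0 = 2*a^3 + 5*a*b^2 / 2"
    and "cert_zeta3 n 0 = 8 * a^2 * (6*a^2 + 13*a*b + 4*b^2)"
proof -
  show "cert_0 n 0 = 8 * a^3 * b * (3*a + 2*b)"
    unfolding cert_0_def a_def b_def by algebra
  show "cert_1 n 0 = a^2 * (12*a^2 + 16*a*b + 3*b^2)"
    unfolding cert_1_def a_def b_def by algebra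
  show "cert_zeta3 n 0 = 8 * a^2 * (6*a^2 + 13*a*b + 4*b^2)"
    unfolding cert_zeta3_def a_def b_def by algebra
  obtain h :: real where h: "2 * h = 1" and half: "\<And>z. z / 2 = z * h"
    by (rule that[of "1/2"]) auto
  show "cert_2 n 0 = 2*a^3 + 5*a*b^2 / 2"
    unfolding cert_2_def a_def b_def half using h by algebra
qed

lemma G_zeta3_eq:
  fixes n :: nat
  defines "k \<equiv> Suc n"
  shows "(-1) ^ k / (real k ^ 2 * real (2 * k choose k) * real (3 * k choose k))
            * ((7 * real k - 2) / (2 * real k - 1) * (2 * harm (2 * k - 1) - harm (k - 1))
               + 1 / real k) = 1/4 * G_zeta3 n 0"
proof -
  define x where "x = real n"
  define t where "t = (-1) ^ k / (real k ^ 2 * real (2 * k choose k) * real (3 * k choose k))"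
  define A B :: real where "A = harm n" and "B = harm (2 * n)"
  have nz: "x+1 \<noteq> 0" "2*x+1 \<noteq> 0" "2*x+2 \<noteq> 0"
    unfolding x_def by linarith+
  have idx: "2 * k - 1 = Suc (2 * n)" "2 * n + 0 + 2 = Suc (Suc (2 * n))"
    by (simp_all add: k_def)
  have harm1: "harm (2 * k - 1) = B + 1 / (2*x+1)"
    unfolding idx harm_Suc' by (simp add: B_def x_def)
  have k: "real k = x + 1"
    by (simp add: k_def x_def)
  have ld: "log_deriv_zeta3 n 0 (2*n+0+2) = 2 * A - 4 * B - 6 / (2*x+1) - 6 / (2*x+2)"
    unfolding log_deriv_zeta3_def idx harm_Suc'
    by (simp add: A_def B_def x_def harm_expand algebra_simps)
  have mk: "mate_kernel n 0 = - t / ((x+1) * (2*x+1)^2 * (2*x+2)^2)"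
    using mate_kernel_0[of n] by (simp add: t_def k_def x_def)
  have "(3*a + 2*b) / b * (2 * (B + 1 / b) - A) + 1 / a
     = - 1/4 * ((8 * a^3 * b * (3*a + 2*b) * (2 * A - 4 * B - 6 / b - 6 / (2*a))
                 + 8 * a^2 * (6*a^2 + 13*a*b + 4*b^2)) / (a * b^2 * (2*a)^2))"
    if "a \<noteq> 0" "b \<noteq> 0" for a b :: real
    using that by (simp add: field_simps power2_eq_square power3_eq_cube)
  from this[OF nz(1,2)]
  have "(7 * (x+1) - 2) / (2 * (x+1) - 1) * (2 * (B + 1 / (2*x+1)) - A) + 1 / (x+1)
     = - 1/4 * ((cert_0 x 0 * (2 * A - 4 * B - 6 / (2*x+1) - 6 / (2*x+2)) + cert_zeta3 x 0)
                / ((x+1) * (2*x+1)^2 * (2*x+2)^2))"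
    unfolding cert_boundary by (simp add: algebra_simps)
  hence "t * ((7 * (x+1) - 2) / (2 * (x+1) - 1) * (2 * (B + 1 / (2*x+1)) - A) + 1 / (x+1))
           = 1/4 * G_zeta3 n 0"
    unfolding G_zeta3_def ld mk by (simp add: x_def)
  thus ?thesis
    unfolding t_def[symmetric] unfolding k harm1 by (simp add: A_def k_def)
qed

lemma G_zeta4_eq:
  fixes n :: nat
  defines "k \<equiv> Suc n"
  shows "(-1) ^ k / (real k ^ 2 * real (2 * k choose k) * real (3 * k choose k))
            * ((7 * real k - 2) / (2 * real k - 1) * harm_order 2 (k - 1)
               - 3 / (4 * real k ^ 2)) = G_zeta4 n 0"
proof -
  define x where "x = real n"
  define t where "t = (-1) ^ k / (real k ^ 2 * real (2 * k choose k) * real (3 * k choose k))"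
  define H where "H = harm_order 2 n"
  have nz: "x+1 \<noteq> 0" "2*x+1 \<noteq> 0" "2*x+2 \<noteq> 0"
    unfolding x_def by linarith+
  have idx: "2 * n + 0 + 2 = Suc (Suc (2 * n))"
    by simp
  have k: "real k = x + 1"
    by (simp add: k_def x_def)
  have ld: "log_deriv_zeta4 n 0 (2*n+0+2) = - (1 / (2*x+1)) - 1 / (2*x+2)"
    unfolding log_deriv_zeta4_def idx harm_Suc' by (simp add: x_def algebra_simps)
  have mk: "mate_kernel n 0 = - t / ((x+1) * (2*x+1)^2 * (2*x+2)^2)"
    using mate_kernel_0[of n] by (simp add: t_def k_def x_def)
  have "(3*a + 2*b) / b * H - 3 / (4 * a^2)
     = - ((8 * a^3 * b * (3*a + 2*b) * (((- (1 / b) - 1 / (2*a))^2 - H) / 2)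
           + a^2 * (12*a^2 + 16*a*b + 3*b^2) * (- (1 / b) - 1 / (2*a)) + (2*a^3 + 5*a*b^2 / 2))
          / (a * b^2 * (2*a)^2))"
    if "a \<noteq> 0" "b \<noteq> 0" for a b :: real
    using that by (simp add: field_simps power2_eq_square power3_eq_cube)
  from this[OF nz(1,2)]
  have "(7 * (x+1) - 2) / (2 * (x+1) - 1) * H - 3 / (4 * (x+1)^2)
     = - ((cert_0 x 0 * (((- (1 / (2*x+1)) - 1 / (2*x+2))^2 - H) / 2)
           + cert_1 x 0 * (- (1 / (2*x+1)) - 1 / (2*x+2)) + cert_2 x 0)
          / ((x+1) * (2*x+1)^2 * (2*x+2)^2))"
    unfolding cert_boundary by (simp add: algebra_simps)
  hence "t * ((7 * (x+1) - 2) / (2 * (x+1) - 1) * H - 3 / (4 * (x+1)^2)) = G_zeta4 n 0"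
    unfolding G_zeta4_def quad_coeff_def ld mk by (simp add: x_def H_def)
  thus ?thesis
    unfolding t_def[symmetric] unfolding k by (simp add: H_def k_def)
qed

theorem theorem1p7:
  shows "((\<lambda>n. let k = Suc n in
            (-1) ^ k / (real k ^ 2 * real (2 * k choose k) * real (3 * k choose k))
            * ((7 * real k - 2) / (2 * real k - 1) * (2 * harm (2 * k - 1) - harm (k - 1))
               + 1 / real k))
         sums (- (3 / 2) * zeta 3))
       \<and> ((\<lambda>n. let k = Suc n in
            (-1) ^ k / (real k ^ 2 * real (2 * k choose k) * real (3 * k choose k))
            * ((7 * real k - 2) / (2 * real k - 1) * harm_order 2 (k - 1)
               - 3 / (4 * real k ^ 2)))
         sums (pi ^ 4 / 720))"
proof
  show "(\<lambda>n. let k = Suc n in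
            (-1) ^ k / (real k ^ 2 * real (2 * k choose k) * real (3 * k choose k))
            * ((7 * real k - 2) / (2 * real k - 1) * (2 * harm (2 * k - 1) - harm (k - 1))
               + 1 / real k))
         sums (- (3 / 2) * zeta 3)"
    unfolding Let_def G_zeta3_eq
    using sums_mult[OF G_zeta3_sums, of "1/4"] by (simp add: F_zeta3_suminf)
  show "(\<lambda>n. let k = Suc n in
            (-1) ^ k / (real k ^ 2 * real (2 * k choose k) * real (3 * k choose k))
            * ((7 * real k - 2) / (2 * real k - 1) * harm_order 2 (k - 1)
               - 3 / (4 * real k ^ 2)))
         sums (pi ^ 4 / 720)"
    unfolding Let_def G_zeta4_eq using G_zeta4_sums by (simp add: F_zeta4_suminf)
qed

end
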